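(* Let $\bar x\in\mathcal F$ be a KKT point of the quadratic program $\min\{\Phi(x): Ax\le b\}$, where $\Phi(x)=x^\top Qx+2d^\top x$ and $\mathcal F=\{x\in\mathbb R^n: Ax\le b\}$, such that $Q|_{\mathcal H_{I_{\bar x}}}\succ 0$. Let $\nu_R\in\mathbb R$ satisfy $\nu_R\le \Phi(\bar x)$ and let $\beta\in[0,\Phi(\bar x)-\nu_R]$. Let $\bar z\in\mathbb R^n$ be given and consider the conic linear program $(P)$ in the variables $S\in\mathcal S^{n+1}$, $T\in\mathcal S^{m+1}$, $c\in\mathbb R^n$: minimize $c^\top(\bar z-\bar x)$ subject to $T\ge 0$, $S\succeq 0$ and $$\begin{pmatrix} Q & d\\ d^\top & -\nu_R\end{pmatrix}=S+\begin{pmatrix}-A & b\\ \mathbf 0^\top & 1\end{pmatrix}^\top T\begin{pmatrix}-A & b\\ \mathbf 0^\top & 1\end{pmatrix}+\frac12\, g\begin{pmatrix}-c^\top & 1+c^\top\bar x\end{pmatrix}+\frac12\begin{pmatrix}-c\\ 1+c^\top\bar x\end{pmatrix} g^\top,$$ where $g=\begin{pmatrix}Q\bar x+d\\ -\bar x^\top Q\bar x-d^\top\bar x+\beta\end{pmatrix}\in\mathbb R^{n+1}$. Then: (a) If $\bar x$ is a nondegenerate KKT point or $\beta>0$, then $(P)$ is feasible. (b) If $0<\beta<\Phi(\bar x)-\nu_R$, then $(P)$ is strictly feasible.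
   Context: Setting: $Q$ is a real symmetric $n\times n$ matrix with at least one negative eigenvalue, $d\in\mathbb R^n$, $A\in\mathbb R^{m\times n}$, $b\in\mathbb R^m$, and $\mathcal F=\{x\in\mathbb R^n:Ax\le b\}$ is bounded. $\mathcal S^N$ is the set of real symmetric $N\times N$ matrices; $X\ge0$ means entrywise nonnegative, $X\succeq0$ (resp. $X\succ 0$) means positive semidefinite (resp. positive definite). $[m]=\{1,\dots,m\}$ and $a_i^\top$ is the $i$-th row of $A$. For $I\subset[m]$, $A_I$ is the submatrix of rows of $A$ indexed by $I$, and $\mathcal H_I=\{x\in\mathbb R^n:A_Ix=0\}$ (with $\mathcal H_\emptyset=\mathbb R^n$). For $x\in\mathcal F$, $I_x=\{i\in[m]:a_i^\top x=b_i\}$. $Q|_{\mathcal H}\succ0$ means $p^\top Qp>0$ for all nonzero $p\in\mathcal H$ (automatically true if $\mathcal H=\{\mathbf 0\}$). A feasible point $\bar x\in\mathcal F$ is a KKT point if there is $\bar\lambda\in\mathbb R^m$ with $$\bar\lambda\ge0,\qquad Q\bar x+d=-A^\top\bar\lambda,\qquad (A\bar x-b)^\top\bar\lambda=0.$$ It is a nondegenerate KKT point if such a $\bar\lambda$ can be chosen with $\operatorname{rank}(A_{I_{\bar x}})=\operatorname{rank}(A_{J_{\bar\lambda}})=|J_{\bar\lambda}|$, where $J_{\bar\lambda}=\{i\in[m]:\bar\lambda_i>0\}$ (the rank of a matrix with no rows is $0$). Feasible means that there exists $(S,T,c)$ satisfying all constraints; strictly feasible means that there exists a feasible $(S,T,c)$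 with $S\succ0$. *)

theory Defs
  imports "HOL-Analysis.Analysis"
begin

section \<open>Matrices\<close>

text \<open>
  Vectors and matrices bordered by one extra coordinate are indexed by the sum type \<open>'a + 1\<close>,
  with \<open>Inl\<close> for the original coordinates and \<open>Inr\<close> for the last one, where the right summand is
  the one-element type \<open>1\<close>.
\<close>

definition bordered_vec :: "real^'n \<Rightarrow> real \<Rightarrow> real^('n::finite + 1)" where
  "bordered_vec u s = (\<chi> i. case i of Inl k \<Rightarrow> u $ k | Inr _ \<Rightarrow> s)"

text \<open>\<open>bordered_mat B u v s\<close> is the block matrix with rows \<open>(B, u)\<close> and \<open>(v\<^sup>T, s)\<close>.\<close>

definition bordered_mat ::
  "real^'n^'m \<Rightarrow> real^'m \<Rightarrow> real^'n \<Rightarrow> real \<Rightarrow> real^('n::finite + 1)^('m::finite + 1)" where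
  "bordered_mat B u v s =
     (\<chi> i. case i of Inl k \<Rightarrow> bordered_vec (B $ k) (u $ k) | Inr _ \<Rightarrow> bordered_vec v s)"

definition outer_prod :: "real^'n \<Rightarrow> real^'n \<Rightarrow> real^'n^'n" where
  "outer_prod u v = (columnvector u :: real^1^'n) ** (rowvector v :: real^'n^1)"

definition sym_mat :: "real^'n^'n \<Rightarrow> bool" where
  "sym_mat X \<longleftrightarrow> transpose X = X"

definition is_eigenvalue :: "real^'n^'n \<Rightarrow> real \<Rightarrow> bool" where
  "is_eigenvalue X l \<longleftrightarrow> (\<exists>v. v \<noteq> 0 \<and> X *v v = l *\<^sub>R v)"

definition pos_def_on :: "real^'n^'n \<Rightarrow> (real^'n) set \<Rightarrow> bool" where
  "pos_def_on X H \<longleftrightarrow> (\<forall>p\<in>H. p \<noteq> 0 \<longrightarrow> 0 < p \<bullet> (X *v p))"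

definition pos_semidef :: "real^'n^'n \<Rightarrow> bool" where
  "pos_semidef X \<longleftrightarrow> sym_mat X \<and> (\<forall>p. 0 \<le> p \<bullet> (X *v p))"

definition pos_def :: "real^'n^'n \<Rightarrow> bool" where
  "pos_def X \<longleftrightarrow> sym_mat X \<and> pos_def_on X UNIV"

definition nonneg_mat :: "real^'n^'m \<Rightarrow> bool" where
  "nonneg_mat X \<longleftrightarrow> (\<forall>i j. 0 \<le> X $ i $ j)"

text \<open>
  The rank of the submatrix of rows indexed by \<open>I\<close>, as the dimension of its row space (which is
  how \<^const>\<open>rank\<close> is defined); it is \<open>0\<close> for \<open>I = {}\<close>.
\<close>

definition rank_rows :: "real^'n^'m \<Rightarrow> 'm set \<Rightarrow> nat" where
  "rank_rows A I = dim {row i A | i. i \<in> I}"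

lemma rank_rows_UNIV: "rank_rows A UNIV = rank A"
  by (simp add: rank_rows_def row_rank_def rows_def)

definition kernel_rows :: "real^'n^'m \<Rightarrow> 'm set \<Rightarrow> (real^'n) set" where
  "kernel_rows A I = {x. \<forall>i\<in>I. row i A \<bullet> x = 0}"

section \<open>The quadratic program\<close>

definition polyhedron_of :: "real^'n^'m \<Rightarrow> real^'m \<Rightarrow> (real^'n) set" where
  "polyhedron_of A b = {x. \<forall>i. row i A \<bullet> x \<le> b $ i}"

definition qp_objective :: "real^'n^'n \<Rightarrow> real^'n \<Rightarrow> real^'n \<Rightarrow> real" where
  "qp_objective Q d x = x \<bullet> (Q *v x) + 2 * (d \<bullet> x)"

definition active_set :: "real^'n^'m \<Rightarrow> real^'m \<Rightarrow> real^'n \<Rightarrow> 'm set" where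
  "active_set A b x = {i. row i A \<bullet> x = b $ i}"

definition KKT_multiplier ::
  "real^'n^'n \<Rightarrow> real^'n \<Rightarrow> real^'n^'m \<Rightarrow> real^'m \<Rightarrow> real^'n \<Rightarrow> real^'m \<Rightarrow> bool" where
  "KKT_multiplier Q d A b x l \<longleftrightarrow>
     (\<forall>i. 0 \<le> l $ i) \<and> Q *v x + d = - (transpose A *v l) \<and> (A *v x - b) \<bullet> l = 0"

definition KKT_point ::
  "real^'n^'n \<Rightarrow> real^'n \<Rightarrow> real^'n^'m \<Rightarrow> real^'m \<Rightarrow> real^'n \<Rightarrow> bool" where
  "KKT_point Q d A b x \<longleftrightarrow> x \<in> polyhedron_of A b \<and> (\<exists>l. KKT_multiplier Q d A b x l)"

definition nondegenerate_KKT_point ::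
  "real^'n^'n \<Rightarrow> real^'n \<Rightarrow> real^'n^'m \<Rightarrow> real^'m \<Rightarrow> real^'n \<Rightarrow> bool" where
  "nondegenerate_KKT_point Q d A b x \<longleftrightarrow>
     x \<in> polyhedron_of A b \<and>
     (\<exists>l. KKT_multiplier Q d A b x l \<and>
          rank_rows A (active_set A b x) = rank_rows A {i. 0 < l $ i} \<and>
          rank_rows A {i. 0 < l $ i} = card {i. 0 < l $ i})"

section \<open>The conic linear program\<close>

record 'a minimization_problem =
  objective :: "'a \<Rightarrow> real"
  feasible_set :: "'a set"

text \<open>
  \<open>cut_vec Q d \<beta> x\<close> is the vector \<open>g\<close> for which \<open>g\<^sup>T (y, 1) = (Q x + d)\<^sup>T (y - x) + \<beta>\<close>.
\<close>

definition cut_vec ::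
  "real^'n^'n \<Rightarrow> real^'n \<Rightarrow> real \<Rightarrow> real^'n \<Rightarrow> real^('n::finite + 1)" where
  "cut_vec Q d \<beta> x = bordered_vec (Q *v x + d) (- (x \<bullet> (Q *v x)) - d \<bullet> x + \<beta>)"

definition conic_program ::
  "real^'n^'n \<Rightarrow> real^'n \<Rightarrow> real^'n^'m \<Rightarrow> real^'m \<Rightarrow> real \<Rightarrow> real \<Rightarrow> real^'n \<Rightarrow> real^'n \<Rightarrow>
   ((real^('n::finite + 1)^('n + 1)) \<times> (real^('m::finite + 1)^('m + 1)) \<times> (real^'n))
     minimization_problem" where
  "conic_program Q d A b \<nu> \<beta> x z =
     (let M = bordered_mat (- A) b 0 1; g = cut_vec Q d \<beta> x in
      \<lparr>objective = (\<lambda>(S, T, c). c \<bullet> (z - x)),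
       feasible_set = {(S, T, c).
         sym_mat S \<and> sym_mat T \<and> nonneg_mat T \<and> pos_semidef S \<and>
         bordered_mat Q d d (- \<nu>) =
           S + transpose M ** T ** M
             + (1/2) *\<^sub>R outer_prod g (bordered_vec (- c) (1 + c \<bullet> x))
             + (1/2) *\<^sub>R outer_prod (bordered_vec (- c) (1 + c \<bullet> x)) g}\<rparr>)"

definition feasible :: "'a minimization_problem \<Rightarrow> bool" where
  "feasible P \<longleftrightarrow> (\<exists>p. p \<in> feasible_set P)"

definition strictly_feasible :: "((real^'k^'k) \<times> 'b \<times> 'c) minimization_problem \<Rightarrow> bool" where
  "strictly_feasible P \<longleftrightarrow> (\<exists>S T c. (S, T, c) \<in> feasible_set P \<and> pos_def S)"

end

theory Submission
  imports Defs
begin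

text \<open>
  Put \<open>y = x - t xbar\<close>, \<open>q = Q xbar + d\<close>, \<open>\<delta> = \<Phi>(xbar) - \<nu>\<close> and let \<open>s = t (b - A xbar) - A y\<close> be the
  slack vector. Reading the matrix equation as an identity of quadratic forms in \<open>(x, t)\<close>, it
  determines \<open>S\<close> from \<open>T\<close> and \<open>c\<close>:
  \<open>S = y\<^sup>TQy + 2 t q\<^sup>Ty + \<delta> t\<^sup>2 - T(s, t) - (q\<^sup>Ty + \<beta> t)(t - c\<^sup>Ty)\<close>, and \<open>q\<^sup>Ty = \<lambda>\<^sup>Ts\<close>.
  It suffices to choose \<open>T\<close> and \<open>c\<close> so that \<open>S = y\<^sup>TQy + \<rho> \<Sum>i (u\<^sub>i\<^sup>Ty)\<^sup>2 + (\<delta> - \<beta>) t\<^sup>2\<close>, where the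
  common kernel of the \<open>u\<^sub>i\<close> is the one of the active rows: by Finsler's lemma the first two terms
  form a positive definite form once \<open>\<rho>\<close> is large.

  If \<open>xbar\<close> is nondegenerate, the active rows have the same span as the rows with positive multiplier.
  Take \<open>c = \<rho> q\<close>; the squares come from \<open>(q\<^sup>Ty)\<^sup>2 = (\<lambda>\<^sup>Ts)\<^sup>2\<close>, whose mixed terms are
  absorbed by \<open>T\<close>.

  If \<open>\<beta> > 0\<close>, boundedness makes the cone generated by the rows of \<open>A\<close> the whole space, so for each
  row \<open>j\<close> there are \<open>p\<^sub>j \<ge> 0\<close> and \<open>R\<^sub>j \<ge> 0\<close> with \<open>R\<^sub>j t = s\<^sub>j + p\<^sub>j\<^sup>Ts + t\<close> whenever \<open>j\<close> is active. Taking
  \<open>c\<^sup>Ty\<close> to be a multiple of \<open>\<Sum>j R\<^sub>j s\<^sub>j\<close> over the active rows, the term \<open>\<beta> t c\<^sup>Ty\<close> yields the squares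
  \<open>s\<^sub>j\<^sup>2\<close> of all active slacks.
\<close>

section \<open>Bordered vectors and matrices\<close>

lemma UNIV_plus_one: "(UNIV :: ('a::finite + 1) set) = Inl ` UNIV \<union> {Inr 1}"
proof -
  have "x \<in> Inl ` UNIV \<union> {Inr 1}" for x :: "'a + 1"
    by (cases x) (auto simp: num1_eq_iff)
  then show ?thesis by blast
qed

lemma sum_plus_one:
  fixes f :: "'a::finite + 1 \<Rightarrow> 'b::comm_monoid_add"
  shows "(\<Sum>i\<in>UNIV. f i) = (\<Sum>i\<in>UNIV. f (Inl i)) + f (Inr 1)"
proof -
  have "(\<Sum>i\<in>UNIV. f i) = (\<Sum>i\<in>range Inl. f i) + f (Inr 1)"
    unfolding UNIV_plus_one by (subst sum.union_disjoint) auto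
  then show ?thesis by (simp add: sum.reindex)
qed

lemma bordered_vec_Inl [simp]: "bordered_vec u s $ Inl k = u $ k"
  and bordered_vec_Inr [simp]: "bordered_vec u s $ Inr j = s"
  by (simp_all add: bordered_vec_def)

lemma bordered_vec_cases:
  fixes v :: "real^('n::finite + 1)"
  obtains x t where "v = bordered_vec x t"
proof
  show "v = bordered_vec (\<chi> k. v $ Inl k) (v $ Inr 1)"
    by (auto simp: vec_eq_iff bordered_vec_def split: sum.splits)
qed

lemma inner_bordered_vec [simp]: "bordered_vec u s \<bullet> bordered_vec v t = u \<bullet> v + s * t"
  by (simp add: inner_vec_def sum_plus_one)

lemma bordered_vec_eq_0_iff [simp]: "bordered_vec u s = 0 \<longleftrightarrow> u = 0 \<and> s = 0"
  by (metis inner_bordered_vec inner_eq_zero_iff inner_ge_zero inner_real_def add_nonneg_eq_0_iff)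

lemma bordered_mat_mult_vec:
  "bordered_mat B u v s *v bordered_vec x t = bordered_vec (B *v x + t *\<^sub>R u) (v \<bullet> x + s * t)"
  by (simp add: vec_eq_iff bordered_mat_def matrix_vector_mult_def sum_plus_one bordered_vec_def
      inner_vec_def split: sum.splits)

lemma sym_mat_bordered:
  assumes "sym_mat Q"
  shows "sym_mat (bordered_mat Q d d s)"
  using assms
  by (simp add: sym_mat_def vec_eq_iff transpose_def bordered_mat_def bordered_vec_def
      split: sum.splits)

lemma outer_prod_nth: "outer_prod u v $ i $ j = u $ i * v $ j"
  by (simp add: outer_prod_def matrix_matrix_mult_def columnvector_def rowvector_def)

lemma outer_prod_mult_vec: "outer_prod u v *v w = (v \<bullet> w) *\<^sub>R u"
  by (simp add: vec_eq_iff matrix_vector_mult_def outer_prod_nth inner_vec_def sum_distrib_right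
      sum_distrib_left mult_ac)

lemma transpose_outer_prod: "transpose (outer_prod u v) = outer_prod v u"
  by (simp add: vec_eq_iff transpose_def outer_prod_nth mult.commute)

lemma transpose_add: "transpose (X + Y) = transpose X + transpose Y"
  for X Y :: "'a::ab_group_add^'n^'m"
  by (simp add: vec_eq_iff transpose_def)

lemma transpose_diff: "transpose (X - Y) = transpose X - transpose Y"
  for X Y :: "'a::ab_group_add^'n^'m"
  by (simp add: vec_eq_iff transpose_def)

lemma transpose_zero: "transpose 0 = 0"
  by (simp add: vec_eq_iff transpose_def)

lemma inner_matrix_transpose: "u \<bullet> (transpose X *v w) = (X *v u) \<bullet> w"
  for X :: "real^'n^'m"
  by (metis dot_lmul_matrix inner_commute transpose_transpose vector_transpose_matrix)

lemma matrix_vector_mult_nth: "(X *v y) $ i = row i X \<bullet> y"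
  for X :: "real^'n^'m"
  by (simp add: matrix_vector_mul_component row_def vec_nth_inverse)

lemma uminus_matrix_vector_mult: "(- X) *v y = - (X *v y)"
  for X :: "real^'n^'m"
  by (simp add: vec_eq_iff matrix_vector_mult_def sum_negf)

lemma sym_mat_congruence:
  assumes "sym_mat X"
  shows "sym_mat (transpose M ** X ** M)"
  using assms by (simp add: sym_mat_def matrix_transpose_mul matrix_mul_assoc)

section \<open>Quadratic forms with nonnegative coefficients\<close>

text \<open>Hides the witness \<open>T\<close>: it is assembled from products of nonnegative linear
  forms, and later arguments compute only with its quadratic form.\<close>

definition nonneg_form :: "(real^'k \<Rightarrow> real) \<Rightarrow> bool" where
  "nonneg_form f \<longleftrightarrow> (\<exists>T. sym_mat T \<and> nonneg_mat T \<and> (\<forall>w. w \<bullet> (T *v w) = f w))"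

lemma nonneg_form_mult:
  assumes "\<And>i. 0 \<le> u $ i" "\<And>i. 0 \<le> v $ i"
  shows "nonneg_form (\<lambda>w. (u \<bullet> w) * (v \<bullet> w))"
  unfolding nonneg_form_def
proof (intro exI conjI allI)
  let ?T = "(1/2) *\<^sub>R (outer_prod u v + outer_prod v u)"
  show "sym_mat ?T"
    by (simp add: sym_mat_def transpose_scalar transpose_add transpose_outer_prod add.commute)
  show "nonneg_mat ?T"
    using assms by (simp add: nonneg_mat_def outer_prod_nth)
  show "w \<bullet> (?T *v w) = (u \<bullet> w) * (v \<bullet> w)" for w
    by (simp add: scaleR_matrix_vector_assoc [symmetric] matrix_vector_mult_add_rdistrib
        outer_prod_mult_vec inner_commute algebra_simps)
qed

lemma nonneg_form_add:
  assumes "nonneg_form f" "nonneg_form h"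
  shows "nonneg_form (\<lambda>w. f w + h w)"
proof -
  obtain T U where "sym_mat T" "nonneg_mat T" "\<And>w. w \<bullet> (T *v w) = f w"
    and "sym_mat U" "nonneg_mat U" "\<And>w. w \<bullet> (U *v w) = h w"
    using assms unfolding nonneg_form_def by blast
  then show ?thesis
    unfolding nonneg_form_def
    by (intro exI [of _ "T + U"])
      (simp add: sym_mat_def nonneg_mat_def transpose_add matrix_vector_mult_add_rdistrib
        inner_add_right)
qed

lemma nonneg_form_scale:
  assumes "nonneg_form f" "0 \<le> k"
  shows "nonneg_form (\<lambda>w. k * f w)"
proof -
  obtain T where "sym_mat T" "nonneg_mat T" "\<And>w. w \<bullet> (T *v w) = f w"
    using assms(1) unfolding nonneg_form_def by blast
  then show ?thesis
    unfolding nonneg_form_def using assms(2)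
    by (intro exI [of _ "k *\<^sub>R T"])
      (simp add: sym_mat_def nonneg_mat_def transpose_scalar scaleR_matrix_vector_assoc [symmetric])
qed

lemma nonneg_form_sum:
  assumes "\<And>i. i \<in> I \<Longrightarrow> nonneg_form (f i)"
  shows "nonneg_form (\<lambda>w. \<Sum>i\<in>I. f i w)"
  using assms
proof (induction I rule: infinite_finite_induct)
  case (insert i I)
  then show ?case by (simp add: nonneg_form_add)
\<comment> \<open>A sum over an infinite \<open>I\<close> is 0 by default, so the zero matrix serves
  there as for the empty set.\<close>
qed (auto simp: nonneg_form_def sym_mat_def nonneg_mat_def transpose_zero intro!: exI [of _ 0])

section \<open>Finsler's lemma\<close>

text \<open>Compactness: on the part of the unit sphere where the form is nonpositive, the penalty
  is positive, hence bounded away from 0, and a large \<rho> outweighs the form. Homogeneity carries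
  this to every nonzero \<open>y\<close>.\<close>

lemma finsler:
  fixes Q :: "real^'n^'n" and u :: "'i \<Rightarrow> real^'n"
  assumes "finite I" and "pos_def_on Q {x. \<forall>i\<in>I. u i \<bullet> x = 0}"
  obtains \<rho> where "0 < \<rho>" "\<And>y. y \<noteq> 0 \<Longrightarrow> 0 < y \<bullet> (Q *v y) + \<rho> * (\<Sum>i\<in>I. (u i \<bullet> y)\<^sup>2)"
proof -
  let ?f = "\<lambda>y. y \<bullet> (Q *v y)" and ?h = "\<lambda>y. \<Sum>i\<in>I. (u i \<bullet> y)\<^sup>2"
  have cf: "continuous_on X ?f" for X
    by (intro continuous_intros linear_continuous_on matrix_vector_mul_bounded_linear)
  have ch: "continuous_on X ?h" for X
    by (intro continuous_intros)
  define K where "K = sphere 0 1 \<inter> {y. ?f y \<le> 0}"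
  have "compact K"
    unfolding K_def
    by (intro compact_Int_closed compact_sphere closed_Collect_le cf continuous_intros)
  have h_pos: "0 < ?h y" if "y \<in> K" for y
  proof -
    have "\<not> (\<forall>i\<in>I. u i \<bullet> y = 0)"
      using that assms(2) by (force simp: K_def pos_def_on_def)
    then obtain i where "i \<in> I" "u i \<bullet> y \<noteq> 0" by blast
    then show ?thesis using assms(1) by (intro sum_pos2 [of _ i]) auto
  qed
  obtain \<rho> where "0 < \<rho>" and \<rho>: "\<And>y. y \<in> K \<Longrightarrow> 0 < ?f y + \<rho> * ?h y"
  proof (cases "K = {}")
    case True
    with that [of 1] show ?thesis by simp
  next
    case False
    obtain y0 where y0: "y0 \<in> K" "\<And>y. y \<in> K \<Longrightarrow> ?h y0 \<le> ?h y"
      using continuous_attains_inf [OF \<open>compact K\<close> False ch] by blast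
    obtain y1 where y1: "y1 \<in> K" "\<And>y. y \<in> K \<Longrightarrow> ?f y1 \<le> ?f y"
      using continuous_attains_inf [OF \<open>compact K\<close> False cf] by blast
    \<comment> \<open>Since \<open>?f y1\<close> and \<open>?h y0\<close> are minima over
      \<open>K\<close>, this value makes \<open>?f y + \<rho> * ?h y\<close> at least 1 on
      \<open>K\<close>.\<close>
    define \<rho> where "\<rho> = (1 - ?f y1) / ?h y0"
    have "0 < ?h y0" "?f y1 \<le> 0"
      using h_pos [OF y0(1)] y1(1) by (auto simp: K_def)
    then have "0 < \<rho>" by (simp add: \<rho>_def)
    moreover have "0 < ?f y + \<rho> * ?h y" if "y \<in> K" for y
    proof -
      have "1 - ?f y1 = \<rho> * ?h y0" using \<open>0 < ?h y0\<close> by (simp add: \<rho>_def)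
      also have "\<dots> \<le> \<rho> * ?h y" using y0(2) [OF that] \<open>0 < \<rho>\<close> by simp
      finally show ?thesis using y1(2) [OF that] by linarith
    qed
    ultimately show ?thesis by (rule that)
  qed
  have "0 < ?f y + \<rho> * ?h y" if "y \<noteq> 0" for y
  proof -
    define z where "z = y /\<^sub>R norm y"
    have "norm z = 1" using that by (simp add: z_def)
    have "0 < ?f z + \<rho> * ?h z"
    proof (cases "z \<in> K")
      case False
      with \<open>norm z = 1\<close> have "0 < ?f z" by (simp add: K_def)
      moreover have "0 \<le> \<rho> * ?h z" using \<open>0 < \<rho>\<close> by (simp add: sum_nonneg)
      ultimately show ?thesis by linarith
    qed (rule \<rho>)
    moreover have "?f y + \<rho> * ?h y = (norm y)\<^sup>2 * (?f z + \<rho> * ?h z)"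
    proof -
      have y: "y = norm y *\<^sub>R z" using that by (simp add: z_def)
      have "?f y = (norm y)\<^sup>2 * ?f z"
        by (subst (1 2) y) (simp add: matrix_vector_mult_scaleR power2_eq_square)
      moreover have "?h y = (norm y)\<^sup>2 * ?h z"
        by (subst (1) y) (simp add: power_mult_distrib sum_distrib_left)
      ultimately show ?thesis by (simp add: algebra_simps)
    qed
    ultimately show ?thesis using that by simp
  qed
  with \<open>0 < \<rho>\<close> show ?thesis by (rule that)
qed

section \<open>Consequences of boundedness and nondegeneracy\<close>

text \<open>If \<open>v\<close> lay outside the cone generated by the rows, the normal of a
  separating hyperplane would be a nonzero recession direction, and moving along it from
  \<open>x\<close> would contradict boundedness.\<close>

lemma conic_combination_of_rows:
  fixes A :: "real^'n^'m" and v :: "real^'n"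
  assumes "bounded (polyhedron_of A b)" "x \<in> polyhedron_of A b"
  obtains p where "\<And>i. 0 \<le> p $ i" "transpose A *v p = v"
proof -
  define K where "K = {transpose A *v p | p. \<forall>i. 0 \<le> p $ i}"
  have "v \<in> K"
  proof (rule ccontr)
    assume "v \<notin> K"
    have "convex K"
    proof (rule convexI)
      fix k l and s t :: real
      assume "k \<in> K" "l \<in> K" "0 \<le> s" "0 \<le> t"
      then obtain p q where "k = transpose A *v p" "l = transpose A *v q"
        "\<forall>i. 0 \<le> p $ i" "\<forall>i. 0 \<le> q $ i"
        unfolding K_def by blast
      then show "s *\<^sub>R k + t *\<^sub>R l \<in> K"
        unfolding K_def using \<open>0 \<le> s\<close> \<open>0 \<le> t\<close>
        by (intro CollectI exI [of _ "s *\<^sub>R p + t *\<^sub>R q"])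
          (simp add: matrix_vector_right_distrib matrix_vector_mult_scaleR)
    qed
    moreover have "transpose A *v 0 \<in> K" unfolding K_def by fastforce
    ultimately obtain y \<gamma> where "y \<noteq> 0" and y: "\<And>k. k \<in> K \<Longrightarrow> y \<bullet> k \<le> \<gamma>"
      using separating_hyperplane_sets [of K "{v}"] \<open>v \<notin> K\<close> by auto
    \<comment> \<open>A linear function bounded above on a cone is nonpositive on it: \<tau> scales
      the ray through row \<open>i\<close> past the bound \<gamma>.\<close>
    have recession: "row i A \<bullet> y \<le> 0" for i
    proof (rule ccontr)
      assume "\<not> row i A \<bullet> y \<le> 0"
      then have pos: "0 < row i A \<bullet> y" by simp
      define \<tau> where "\<tau> = (\<bar>\<gamma>\<bar> + 1) / (row i A \<bullet> y)"
      have "0 \<le> \<tau>" using pos by (simp add: \<tau>_def)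
      then have "transpose A *v (\<tau> *\<^sub>R axis i 1) \<in> K"
        unfolding K_def by (intro CollectI exI conjI refl) (auto simp: axis_def)
      from y [OF this] have "\<tau> * ((A *v y) $ i) \<le> \<gamma>"
        by (simp only: inner_matrix_transpose inner_scaleR_right inner_axis inner_real_def mult_1_right)
      then have "\<bar>\<gamma>\<bar> + 1 \<le> \<gamma>" using pos by (simp add: \<tau>_def matrix_vector_mult_nth)
      then show False by simp
    qed
    obtain B where B: "\<And>z. z \<in> polyhedron_of A b \<Longrightarrow> norm z \<le> B"
      using assms(1) by (auto simp: bounded_iff)
    \<comment> \<open>The step gets length \<open>B + norm x + 1\<close>, one more than the triangle
      inequality permits inside the polyhedron.\<close>
    define \<tau> where "\<tau> = (B + norm x + 1) / norm y"
    have "0 \<le> B" using B [OF assms(2)] norm_ge_zero order_trans by blast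
    then have "0 \<le> \<tau>" by (simp add: \<tau>_def)
    have "x + \<tau> *\<^sub>R y \<in> polyhedron_of A b"
      using assms(2) recession \<open>0 \<le> \<tau>\<close>
      by (auto simp: polyhedron_of_def inner_add_right intro!: add_decreasing2 mult_nonneg_nonpos)
    then have "norm (x + \<tau> *\<^sub>R y) \<le> B" by (rule B)
    moreover have "norm (\<tau> *\<^sub>R y) = B + norm x + 1"
      using \<open>y \<noteq> 0\<close> \<open>0 \<le> B\<close> by (simp add: \<tau>_def)
    moreover have "norm (\<tau> *\<^sub>R y) \<le> norm (x + \<tau> *\<^sub>R y) + norm x"
      using norm_triangle_ineq4 [of "x + \<tau> *\<^sub>R y" x] by simp
    ultimately show False by linarith
  qed
  then show ?thesis using that unfolding K_def by blast
qed

text \<open>Nested spans of equal dimension coincide, and the kernel is the orthogonal complement of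
  the span. This turns the rank condition of nondegeneracy into a statement about kernels.\<close>

lemma kernel_rows_eq:
  fixes A :: "real^'n^'m"
  assumes "J \<subseteq> I" "rank_rows A I = rank_rows A J"
  shows "kernel_rows A I = kernel_rows A J"
proof
  show "kernel_rows A I \<subseteq> kernel_rows A J"
    using assms(1) by (auto simp: kernel_rows_def)
  have "span {row i A |i. i \<in> J} = span {row i A |i. i \<in> I}"
    using assms by (intro dim_eq_span) (auto simp: rank_rows_def)
  then have "row i A \<in> span {row i A |i. i \<in> J}" if "i \<in> I" for i
    using that by (auto intro: span_base)
  then show "kernel_rows A J \<subseteq> kernel_rows A I"
    using orthogonal_to_span [of _ "{row i A |i. i \<in> J}"]
    by (fastforce simp: kernel_rows_def orthogonal_def inner_commute)
qed

section \<open>Feasibility certificates\<close>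

text \<open>Reduces feasibility to a scalar identity: \<open>F\<close> is the form of
  \<open>T\<close> at \<open>(s, t)\<close>, \<open>h\<close> is the term that makes
  \<open>Q\<close> definite, and the assumed identity leaves
  \<open>y\<^sup>TQy + h y + (\<delta> - \<beta>) t\<^sup>2\<close> as the form of
  \<open>S\<close>.\<close>

lemma conic_program_feasibleI:
  fixes Q :: "real^'n^'n" and A :: "real^'n^'m" and u :: "'i \<Rightarrow> real^'n"
  assumes "sym_mat Q"
    and "nonneg_form F"
    and pos: "\<And>y. y \<noteq> 0 \<Longrightarrow> 0 < y \<bullet> (Q *v y) + h y"
    and h0: "h 0 = 0"
    and \<beta>: "\<beta> \<le> qp_objective Q d xbar - \<nu>"
    and F: "\<And>y t. F (bordered_vec (t *\<^sub>R (b - A *v xbar) - A *v y) t) =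
      2 * ((Q *v xbar + d) \<bullet> y) * t + \<beta> * t\<^sup>2 - ((Q *v xbar + d) \<bullet> y + \<beta> * t) * (t - c \<bullet> y) - h y"
  shows "feasible (conic_program Q d A b \<nu> \<beta> xbar zbar)"
    and "\<beta> < qp_objective Q d xbar - \<nu> \<Longrightarrow>
      strictly_feasible (conic_program Q d A b \<nu> \<beta> xbar zbar)"
proof -
  obtain T where T: "sym_mat T" "nonneg_mat T" "\<And>w. w \<bullet> (T *v w) = F w"
    using assms(2) unfolding nonneg_form_def by blast
  define M where "M = bordered_mat (- A) b 0 1"
  define g where "g = cut_vec Q d \<beta> xbar"
  define k where "k = bordered_vec (- c) (1 + c \<bullet> xbar)"
  define \<delta> where "\<delta> = qp_objective Q d xbar - \<nu>"
  \<comment> \<open>\<open>S\<close> is solved from the matrix equation, which then holds by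
    construction.\<close>
  define S where "S = bordered_mat Q d d (- \<nu>) - transpose M ** T ** M
     - (1/2) *\<^sub>R outer_prod g k - (1/2) *\<^sub>R outer_prod k g"
  have sym: "sym_mat S"
    using sym_mat_bordered [OF assms(1)] sym_mat_congruence [OF T(1)]
    by (simp add: sym_mat_def S_def transpose_diff transpose_scalar transpose_outer_prod)
  have form: "bordered_vec x t \<bullet> (S *v bordered_vec x t) =
      (x - t *\<^sub>R xbar) \<bullet> (Q *v (x - t *\<^sub>R xbar)) + h (x - t *\<^sub>R xbar) + (\<delta> - \<beta>) * t\<^sup>2" for x t
  proof -
    \<comment> \<open>In coordinates centred at \<open>xbar\<close>, \<open>M\<close> produces the
      slack vector, and the vectors \<open>g\<close> and \<open>k\<close> become the linear forms
      \<open>(Q *v xbar + d) \<bullet> y + \<beta> * t\<close> and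
      \<open>t - c \<bullet> y\<close>.\<close>
    define y where "y = x - t *\<^sub>R xbar"
    have x: "x = y + t *\<^sub>R xbar" by (simp add: y_def)
    let ?v = "bordered_vec x t"
    have Q_comm: "y \<bullet> (Q *v xbar) = xbar \<bullet> (Q *v y)"
      using assms(1) inner_matrix_transpose [of y Q xbar] by (simp add: sym_mat_def inner_commute)
    have "M *v ?v = bordered_vec (t *\<^sub>R (b - A *v xbar) - A *v y) t"
      by (simp add: M_def bordered_mat_mult_vec x matrix_vector_right_distrib
          matrix_vector_mult_scaleR uminus_matrix_vector_mult algebra_simps)
    then have "?v \<bullet> ((transpose M ** T ** M) *v ?v) =
        F (bordered_vec (t *\<^sub>R (b - A *v xbar) - A *v y) t)"
      by (simp only: matrix_vector_mul_assoc [symmetric] inner_matrix_transpose T(3))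
    moreover have "?v \<bullet> (bordered_mat Q d d (- \<nu>) *v ?v) =
        y \<bullet> (Q *v y) + 2 * ((Q *v xbar + d) \<bullet> y) * t + \<delta> * t\<^sup>2"
      using Q_comm
      by (simp add: bordered_mat_mult_vec x matrix_vector_right_distrib matrix_vector_mult_scaleR
          \<delta>_def qp_objective_def inner_simps inner_commute power2_eq_square algebra_simps)
    moreover have "g \<bullet> ?v = (Q *v xbar + d) \<bullet> y + \<beta> * t"
      by (simp add: g_def cut_vec_def x inner_simps inner_commute algebra_simps)
    moreover have "k \<bullet> ?v = t - c \<bullet> y"
      by (simp add: k_def x inner_simps algebra_simps)
    moreover have "?v \<bullet> (S *v ?v) = ?v \<bullet> (bordered_mat Q d d (- \<nu>) *v ?v)
        - ?v \<bullet> ((transpose M ** T ** M) *v ?v) - (g \<bullet> ?v) * (k \<bullet> ?v)"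
      by (simp add: S_def matrix_vector_mult_diff_rdistrib scaleR_matrix_vector_assoc [symmetric]
          outer_prod_mult_vec inner_diff_right inner_commute [of ?v g] inner_commute [of ?v k])
    ultimately have "?v \<bullet> (S *v ?v) = y \<bullet> (Q *v y) + h y + (\<delta> - \<beta>) * t\<^sup>2"
      by (simp only: F) (simp only: algebra_simps)
    then show ?thesis by (simp only: y_def)
  qed
  have nonneg: "0 \<le> y \<bullet> (Q *v y) + h y" for y
    using pos [of y] h0 by (cases "y = 0") auto
  have psd: "pos_semidef S"
    unfolding pos_semidef_def
  proof (intro conjI allI sym)
    fix v :: "real^('n + 1)"
    obtain x t where "v = bordered_vec x t" by (rule bordered_vec_cases)
    then show "0 \<le> v \<bullet> (S *v v)" using form nonneg \<beta> by (simp add: \<delta>_def)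
  qed
  have mem: "(S, T, c) \<in> feasible_set (conic_program Q d A b \<nu> \<beta> xbar zbar)"
    using T sym psd
    by (simp add: conic_program_def Let_def S_def M_def g_def k_def)
  then show "feasible (conic_program Q d A b \<nu> \<beta> xbar zbar)"
    unfolding feasible_def by blast
  assume "\<beta> < qp_objective Q d xbar - \<nu>"
  then have "0 < \<delta> - \<beta>" by (simp add: \<delta>_def)
  have "pos_def S"
    unfolding pos_def_def pos_def_on_def
  proof (intro conjI ballI impI sym)
    fix v :: "real^('n + 1)"
    assume "v \<noteq> 0"
    obtain x t where v: "v = bordered_vec x t" by (rule bordered_vec_cases)
    show "0 < v \<bullet> (S *v v)"
    proof (cases "t = 0")
      case True
      with \<open>v \<noteq> 0\<close> pos show ?thesis by (simp add: v form)
    next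
      case False
      then have "0 < (\<delta> - \<beta>) * t\<^sup>2" using \<open>0 < \<delta> - \<beta>\<close> by simp
      with nonneg show ?thesis unfolding v form by (intro add_nonneg_pos)
    qed
  qed
  with mem show "strictly_feasible (conic_program Q d A b \<nu> \<beta> xbar zbar)"
    unfolding strictly_feasible_def by blast
qed

text \<open>Complementarity makes a sum of nonnegative terms vanish, hence each term. With
  stationarity, the gradient term becomes a nonnegative combination of slacks, a form that
  \<open>T\<close> can represent.\<close>

lemma slack_multiplier:
  fixes A :: "real^'n^'m"
  assumes "xbar \<in> polyhedron_of A b" "KKT_multiplier Q d A b xbar l"
  shows "l $ i * (b - A *v xbar) $ i = 0"
    and "l \<bullet> (t *\<^sub>R (b - A *v xbar) - A *v y) = (Q *v xbar + d) \<bullet> y"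
proof -
  let ?r = "b - A *v xbar"
  have r0: "0 \<le> ?r $ j" for j
    using assms(1) by (simp add: polyhedron_of_def matrix_vector_mult_nth)
  have l0: "0 \<le> l $ j" for j using assms(2) by (simp add: KKT_multiplier_def)
  have l_r: "l \<bullet> ?r = 0"
    using assms(2) by (simp add: KKT_multiplier_def inner_diff_left inner_diff_right inner_commute)
  then have "(\<Sum>j\<in>UNIV. l $ j * ?r $ j) = 0" by (simp add: inner_vec_def)
  then show "l $ i * ?r $ i = 0"
    using sum_nonneg_0 [of UNIV "\<lambda>j. l $ j * ?r $ j"] r0 l0
    by (metis UNIV_I finite mult_nonneg_nonneg)
  have "l \<bullet> (A *v y) = - ((Q *v xbar + d) \<bullet> y)"
    using assms(2) inner_matrix_transpose [of y A l]
    by (simp add: KKT_multiplier_def inner_commute)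
  then show "l \<bullet> (t *\<^sub>R ?r - A *v y) = (Q *v xbar + d) \<bullet> y"
    using l_r by (simp add: inner_diff_right [of l "t *\<^sub>R ?r"])
qed

text \<open>Covers \<beta> = 0, where the squares have to come from
  \<open>(q \<bullet> y) * (c \<bullet> y)\<close>.\<close>

lemma conic_program_feasible_nondegenerate:
  fixes Q :: "real^'n^'n" and A :: "real^'n^'m"
  assumes "sym_mat Q"
    and pd: "pos_def_on Q (kernel_rows A (active_set A b xbar))"
    and "nondegenerate_KKT_point Q d A b xbar"
    and "0 \<le> \<beta>" "\<beta> \<le> qp_objective Q d xbar - \<nu>"
  shows "feasible (conic_program Q d A b \<nu> \<beta> xbar zbar)"
proof -
  obtain l where feas: "xbar \<in> polyhedron_of A b" and l: "KKT_multiplier Q d A b xbar l"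
    and rank: "rank_rows A (active_set A b xbar) = rank_rows A {i. 0 < l $ i}"
    using assms(3) unfolding nondegenerate_KKT_point_def by blast
  note slack = slack_multiplier [OF feas l]
  have l0: "0 \<le> l $ i" for i using l by (simp add: KKT_multiplier_def)
  have "{i. 0 < l $ i} \<subseteq> active_set A b xbar"
  proof
    fix i
    assume "i \<in> {i. 0 < l $ i}"
    then have "(b - A *v xbar) $ i = 0" using slack(1) [of i] by simp
    then show "i \<in> active_set A b xbar"
      by (simp add: active_set_def matrix_vector_mult_nth)
  qed
  \<comment> \<open>Weighting each row by its multiplier leaves only the rows with positive
    multiplier as constraints.\<close>
  from kernel_rows_eq [OF this rank]
  have "kernel_rows A (active_set A b xbar) = {y. \<forall>i\<in>UNIV. (l $ i *\<^sub>R row i A) \<bullet> y = 0}"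
    using l0 unfolding kernel_rows_def by (fastforce simp: order_less_le)
  with pd have "pos_def_on Q {y. \<forall>i\<in>UNIV. (l $ i *\<^sub>R row i A) \<bullet> y = 0}" by (simp only:)
  then obtain \<rho> where "0 < \<rho>" and \<rho>:
    "\<And>y. y \<noteq> 0 \<Longrightarrow> 0 < y \<bullet> (Q *v y) + \<rho> * (\<Sum>i\<in>UNIV. ((l $ i *\<^sub>R row i A) \<bullet> y)\<^sup>2)"
    using finsler [OF finite, of Q UNIV "\<lambda>i. l $ i *\<^sub>R row i A"] by blast
  define q where "q = Q *v xbar + d"
  \<comment> \<open>For \<open>c = \<rho> *\<^sub>R q\<close> the identity asks for
    \<open>(1 + \<beta> * \<rho>) * (q \<bullet> y) * t\<close> plus \<rho> times \<open>(l
    \<bullet> s)\<^sup>2 - \<Sum>i (l\<^sub>i s\<^sub>i)\<^sup>2\<close>. The difference consists of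
    mixed products only; \<open>l - axis i (l $ i)\<close> is \<open>l\<close> with entry
    \<open>i\<close> removed.\<close>
  define F where "F w = (1 + \<beta> * \<rho>) * ((bordered_vec l 0 \<bullet> w) * (bordered_vec 0 1 \<bullet> w)) +
    \<rho> * (\<Sum>i\<in>UNIV. (bordered_vec (axis i (l $ i)) 0 \<bullet> w) *
      (bordered_vec (l - axis i (l $ i)) 0 \<bullet> w))" for w
  have "nonneg_form F"
    unfolding F_def using l0 \<open>0 < \<rho>\<close> \<open>0 \<le> \<beta>\<close>
    by (intro nonneg_form_add nonneg_form_scale nonneg_form_sum nonneg_form_mult)
      (auto simp: bordered_vec_def axis_def split: sum.splits)
  moreover have "F (bordered_vec (t *\<^sub>R (b - A *v xbar) - A *v y) t) =
      2 * (q \<bullet> y) * t + \<beta> * t\<^sup>2 - (q \<bullet> y + \<beta> * t) * (t - (\<rho> *\<^sub>R q) \<bullet> y)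
      - \<rho> * (\<Sum>i\<in>UNIV. ((l $ i *\<^sub>R row i A) \<bullet> y)\<^sup>2)" for y t
  proof -
    define s where "s = t *\<^sub>R (b - A *v xbar) - A *v y"
    have l_s: "l \<bullet> s = q \<bullet> y" unfolding s_def q_def by (rule slack)
    \<comment> \<open>Complementarity cancels the \<open>t\<close> part of the weighted
      slack.\<close>
    have li_s: "axis i (l $ i) \<bullet> s = - ((l $ i *\<^sub>R row i A) \<bullet> y)" for i
    proof -
      have "s $ i = t * (b - A *v xbar) $ i - row i A \<bullet> y"
        by (simp add: s_def matrix_vector_mult_nth)
      then have "l $ i * s $ i = t * (l $ i * (b - A *v xbar) $ i) - l $ i * (row i A \<bullet> y)"
        by (simp only: right_diff_distrib mult.left_commute)
      then show ?thesis unfolding slack(1) by (simp add: inner_axis')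
    qed
    have "(\<Sum>i\<in>UNIV. (axis i (l $ i) \<bullet> s) * ((l - axis i (l $ i)) \<bullet> s)) =
        (\<Sum>i\<in>UNIV. axis i (l $ i) \<bullet> s) * (l \<bullet> s) - (\<Sum>i\<in>UNIV. (axis i (l $ i) \<bullet> s)\<^sup>2)"
      by (simp add: inner_diff_left right_diff_distrib sum_subtractf sum_distrib_right
          power2_eq_square)
    moreover have "(\<Sum>i\<in>UNIV. axis i (l $ i) \<bullet> s) = l \<bullet> s"
      by (simp add: inner_axis') (simp add: inner_vec_def)
    ultimately have "(\<Sum>i\<in>UNIV. (axis i (l $ i) \<bullet> s) * ((l - axis i (l $ i)) \<bullet> s)) =
        (q \<bullet> y)\<^sup>2 - (\<Sum>i\<in>UNIV. ((l $ i *\<^sub>R row i A) \<bullet> y)\<^sup>2)"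
      unfolding l_s li_s by (simp add: power2_eq_square)
    then have "F (bordered_vec s t) = (1 + \<beta> * \<rho>) * ((q \<bullet> y) * t) +
        \<rho> * ((q \<bullet> y)\<^sup>2 - (\<Sum>i\<in>UNIV. ((l $ i *\<^sub>R row i A) \<bullet> y)\<^sup>2))"
      by (simp add: F_def l_s del: inner_diff_left inner_scaleR_left)
    then show ?thesis
      unfolding s_def [symmetric] inner_scaleR_left [of \<rho> q]
      by (simp add: power2_eq_square algebra_simps)
  qed
  ultimately show ?thesis
    using \<open>sym_mat Q\<close> \<rho> assms(5)
    by (intro conic_program_feasibleI(1)
        [where c = "\<rho> *\<^sub>R q" and h = "\<lambda>y. \<rho> * (\<Sum>i\<in>UNIV. ((l $ i *\<^sub>R row i A) \<bullet> y)\<^sup>2)"])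
      (simp_all add: q_def)
qed

lemma conic_program_feasible_pos:
  fixes Q :: "real^'n^'n" and A :: "real^'n^'m"
  assumes "sym_mat Q"
    and bd: "bounded (polyhedron_of A b)"
    and pd: "pos_def_on Q (kernel_rows A (active_set A b xbar))"
    and "KKT_point Q d A b xbar"
    and "0 < \<beta>" and \<beta>: "\<beta> \<le> qp_objective Q d xbar - \<nu>"
  shows "feasible (conic_program Q d A b \<nu> \<beta> xbar zbar)"
    and "\<beta> < qp_objective Q d xbar - \<nu> \<Longrightarrow>
      strictly_feasible (conic_program Q d A b \<nu> \<beta> xbar zbar)"
proof -
  define I where "I = active_set A b xbar"
  define r where "r = b - A *v xbar"
  define q where "q = Q *v xbar + d"
  obtain l where feas: "xbar \<in> polyhedron_of A b" and l: "KKT_multiplier Q d A b xbar l"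
    using assms(4) unfolding KKT_point_def by blast
  have l0: "0 \<le> l $ i" for i using l by (simp add: KKT_multiplier_def)
  have r0: "0 \<le> r $ i" for i
    using feas by (simp add: r_def polyhedron_of_def matrix_vector_mult_nth)
  \<comment> \<open>Representing the negated row bounds an active slack from above:
    \<open>R j * t - s $ j\<close> becomes a nonnegative combination of slacks and
    \<open>t\<close>.\<close>
  have "\<exists>p. (\<forall>i. 0 \<le> p $ i) \<and> transpose A *v p = - row j A" for j
    using conic_combination_of_rows [OF bd feas] by metis
  then obtain p where p0: "\<And>i j. 0 \<le> p j $ i" and p: "\<And>j. transpose A *v p j = - row j A"
    by metis
  define R where "R j = p j \<bullet> r + 1" for j
  have R0: "0 \<le> R j" for j
    using p0 r0 by (simp add: R_def inner_vec_def sum_nonneg)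
  obtain \<rho> where "0 < \<rho>" and \<rho>:
    "\<And>y. y \<noteq> 0 \<Longrightarrow> 0 < y \<bullet> (Q *v y) + \<rho> * (\<Sum>i\<in>I. (row i A \<bullet> y)\<^sup>2)"
    using finsler [of I Q "\<lambda>i. row i A"] pd unfolding kernel_rows_def I_def by auto
  \<comment> \<open>Here \<beta> > 0 enters: with this scaling of \<open>c\<close>, the term
    \<open>\<beta> * t * (c \<bullet> y)\<close> supplies the squares with weight \<rho>.\<close>
  define \<kappa> where "\<kappa> = \<rho> / \<beta>"
  have "0 < \<kappa>" "\<rho> = \<kappa> * \<beta>" using \<open>0 < \<rho>\<close> \<open>0 < \<beta>\<close> by (simp_all add: \<kappa>_def)
  \<comment> \<open>On active rows \<open>s $ j = - (row j A \<bullet> y)\<close>, so the sign makes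
    \<open>c \<bullet> y\<close> equal to \<kappa> times the sum of the
    \<open>R j * s $ j\<close>.\<close>
  define c where "c = - \<kappa> *\<^sub>R (\<Sum>j\<in>I. R j *\<^sub>R row j A)"
  \<comment> \<open>The three summands are \<open>(q \<bullet> y) * t\<close>,
    \<open>(q \<bullet> y) * (c \<bullet> y)\<close>, and
    \<open>\<beta> * t * (c \<bullet> y)\<close> less the penalty, each written with nonnegative
    coefficients.\<close>
  define F where "F w = (bordered_vec l 0 \<bullet> w) * (bordered_vec 0 1 \<bullet> w)
    + \<kappa> * (\<Sum>j\<in>I. (bordered_vec l 0 \<bullet> w) * (bordered_vec (axis j (R j)) 0 \<bullet> w))
    + \<kappa> * \<beta> * (\<Sum>j\<in>I. (bordered_vec (axis j 1) 0 \<bullet> w) * (bordered_vec (p j) 1 \<bullet> w))" for w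
  have "nonneg_form F"
    unfolding F_def using l0 p0 R0 \<open>0 < \<kappa>\<close> \<open>0 < \<beta>\<close>
    by (intro nonneg_form_add nonneg_form_scale nonneg_form_sum nonneg_form_mult)
      (auto simp: bordered_vec_def axis_def split: sum.splits)
  moreover have "F (bordered_vec (t *\<^sub>R r - A *v y) t) =
      2 * (q \<bullet> y) * t + \<beta> * t\<^sup>2 - (q \<bullet> y + \<beta> * t) * (t - c \<bullet> y)
      - \<rho> * (\<Sum>i\<in>I. (row i A \<bullet> y)\<^sup>2)" for y t
  proof -
    define s where "s = t *\<^sub>R r - A *v y"
    have l_s: "l \<bullet> s = q \<bullet> y"
      unfolding s_def q_def r_def by (rule slack_multiplier [OF feas l])
    have s_nth: "s $ j = - (row j A \<bullet> y)" if "j \<in> I" for j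
      using that by (simp add: s_def r_def matrix_vector_mult_nth I_def active_set_def)
    have p_s: "p j \<bullet> s + t = R j * t - s $ j" if "j \<in> I" for j
    proof -
      have "p j \<bullet> (A *v y) = - (row j A \<bullet> y)"
        using p [of j] inner_matrix_transpose [of y A "p j"] by (simp add: inner_commute)
      then show ?thesis
        unfolding s_nth [OF that] by (simp add: s_def R_def inner_diff_right algebra_simps)
    qed
    have c_y: "c \<bullet> y = \<kappa> * (\<Sum>j\<in>I. R j * s $ j)"
      by (simp add: c_def inner_sum_left s_nth sum_negf)
    have "(\<Sum>j\<in>I. s $ j * (p j \<bullet> s + t)) = t * (\<Sum>j\<in>I. R j * s $ j) - (\<Sum>j\<in>I. (row j A \<bullet> y)\<^sup>2)"
    proof -
      have "s $ j * (p j \<bullet> s + t) = t * (R j * s $ j) - (row j A \<bullet> y)\<^sup>2" if "j \<in> I" for j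
        unfolding p_s [OF that] s_nth [OF that] by (simp add: power2_eq_square algebra_simps)
      then show ?thesis by (simp add: sum_subtractf sum_distrib_left)
    qed
    then have "F (bordered_vec s t) = (q \<bullet> y) * t + (q \<bullet> y) * (c \<bullet> y)
        + \<kappa> * \<beta> * (t * (\<Sum>j\<in>I. R j * s $ j) - (\<Sum>j\<in>I. (row j A \<bullet> y)\<^sup>2))"
      unfolding F_def inner_bordered_vec
      by (simp add: l_s c_y inner_axis' sum_distrib_left [symmetric])
    then show ?thesis
      unfolding s_def [symmetric]
      by (simp add: c_y \<open>\<rho> = \<kappa> * \<beta>\<close> power2_eq_square algebra_simps)
  qed
  ultimately show "feasible (conic_program Q d A b \<nu> \<beta> xbar zbar)"
    and "\<beta> < qp_objective Q d xbar - \<nu> \<Longrightarrow>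
      strictly_feasible (conic_program Q d A b \<nu> \<beta> xbar zbar)"
    using conic_program_feasibleI
      [OF \<open>sym_mat Q\<close>, of F "\<lambda>y. \<rho> * (\<Sum>i\<in>I. (row i A \<bullet> y)\<^sup>2)" \<beta> d xbar \<nu> b A c zbar] \<rho> \<beta>
    unfolding q_def r_def by simp_all
qed

theorem theorem2:
  fixes Q :: "real^'n^'n" and d :: "real^'n" and A :: "real^'n^'m" and b :: "real^'m"
    and xbar zbar :: "real^'n" and \<nu> \<beta> :: real
  assumes "sym_mat Q"
    and "\<exists>l<0. is_eigenvalue Q l"
    and "bounded (polyhedron_of A b)"
    and "KKT_point Q d A b xbar"
    and "pos_def_on Q (kernel_rows A (active_set A b xbar))"
    and "\<nu> \<le> qp_objective Q d xbar"
    and "\<beta> \<in> {0..qp_objective Q d xbar - \<nu>}"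
  shows "(nondegenerate_KKT_point Q d A b xbar \<or> \<beta> > 0 \<longrightarrow>
            feasible (conic_program Q d A b \<nu> \<beta> xbar zbar)) \<and>
         (0 < \<beta> \<and> \<beta> < qp_objective Q d xbar - \<nu> \<longrightarrow>
            strictly_feasible (conic_program Q d A b \<nu> \<beta> xbar zbar))"
  using assms conic_program_feasible_nondegenerate [of Q A b xbar d \<beta> \<nu> zbar]
    conic_program_feasible_pos [of Q A b xbar d \<beta> \<nu> zbar]
  by auto

end
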